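(* Let $\mathcal{H}$ be a complex separable Hilbert space, let $r\ge 2$ be an integer, and let $a_0,\dots,a_{r-1}\in\mathbb{R}$ with $a_{r-1}\ne 0$. Let $\lambda_1,\dots,\lambda_s\in\mathbb{C}$ be the distinct roots of $P(X)=X^r-a_{r-1}X^{r-1}-\cdots-a_0$, with respective multiplicities $m_1,\dots,m_s$. Let $(u_n)_{n\ge 0}\subseteq\mathcal{H}$ satisfy $$u_{n+r}=a_0u_n+a_1u_{n+1}+\cdots+a_{r-1}u_{n+r-1}\qquad\text{for all } n\ge 0.$$ Then there exist unique vectors $v_{i,j}\in\mathcal{H}$, indexed by $1\le i\le s$ and $0\le j\le m_i-1$, such that $$u_n=\sum_{i=1}^s\sum_{j=0}^{m_i-1}v_{i,j}\,n^j\,\lambda_i^n\qquad\text{for all } n\ge 0,$$ where the vectors $v_{i,j}$ are determined by the initial values $u_0,\dots,u_{r-1}$.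
   Context: Convention: $0^0=1$ (so $n^j=1$ when $n=j=0$).
   Formalization: The formal theorem additionally assumes that a_0 and a_1 are not both zero (0 is at most a simple root of P); without this the claim is false, e.g. r=3, P=X^2(X-1), u=(0,1,0,0,...). *)

theory Defs
  imports
    "HOL-Analysis.Analysis"
    "HOL-Computational_Algebra.Polynomial"
    "HOL-Library.FuncSet"
begin

text \<open>
  A complex Hilbert space: a complete normed space whose real scalar multiplication is the
  restriction of a complex one and whose norm is induced by a sesquilinear Hermitian form, linear
  in the first argument. Positive definiteness is contained in the axiom
  \<open>cinner_self\<close>, and \<open>1 *\<^sub>C x = x\<close> in \<open>scaleR_eq_scaleC\<close>.
\<close>

class complex_hilbert_space = banach +
  fixes scaleC :: "complex \<Rightarrow> 'a \<Rightarrow> 'a" (infixr "*\<^sub>C" 75)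
    and cinner :: "'a \<Rightarrow> 'a \<Rightarrow> complex"
  assumes scaleC_add_right: "c *\<^sub>C (x + y) = c *\<^sub>C x + c *\<^sub>C y"
    and scaleC_add_left: "(c + d) *\<^sub>C x = c *\<^sub>C x + d *\<^sub>C x"
    and scaleC_scaleC: "c *\<^sub>C (d *\<^sub>C x) = (c * d) *\<^sub>C x"
    and scaleR_eq_scaleC: "t *\<^sub>R x = complex_of_real t *\<^sub>C x"
    and cinner_commute: "cinner x y = cnj (cinner y x)"
    and cinner_add_left: "cinner (x + y) z = cinner x z + cinner y z"
    and cinner_scaleC_left: "cinner (c *\<^sub>C x) y = c * cinner x y"
    and cinner_self: "cinner x x = complex_of_real ((norm x)\<^sup>2)"

instantiation complex :: complex_hilbert_space
begin

definition scaleC_complex :: "complex \<Rightarrow> complex \<Rightarrow> complex"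
  where "scaleC_complex c x = c * x"

definition cinner_complex :: "complex \<Rightarrow> complex \<Rightarrow> complex"
  where "cinner_complex x y = x * cnj y"

instance
  by standard
    (simp_all add: scaleC_complex_def cinner_complex_def algebra_simps scaleR_conv_of_real
      complex_norm_square del: of_real_power)

end

definition rec_charpoly :: "nat \<Rightarrow> (nat \<Rightarrow> real) \<Rightarrow> complex poly"
  where "rec_charpoly r a = monom 1 r - (\<Sum>k<r. monom (complex_of_real (a k)) k)"

text \<open>
  The index set \<open>{(i, j). 1 \<le> i \<le> s, 0 \<le> j \<le> m i - 1}\<close>. A family of vectors indexed by it is an
  element of \<open>mult_index s m \<rightarrow>\<^sub>E UNIV\<close>: extensionality fixes the irrelevant values outside
  the index set, so that uniqueness of a family is equality of functions.
\<close>

definition mult_index :: "nat \<Rightarrow> (nat \<Rightarrow> nat) \<Rightarrow> (nat \<times> nat) set"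
  where "mult_index s m = (SIGMA i:{1..s}. {..<m i})"

text \<open>
  The sum over \<open>i, j\<close> of \<open>v\<^sub>i\<^sub>j n\<^sup>j \<lambda>\<^sub>i\<^sup>n\<close>. Isabelle's \<open>0 ^ 0 = 1\<close> is the convention
  intended for both powers.
\<close>

definition exp_poly_sum ::
    "nat \<Rightarrow> (nat \<Rightarrow> nat) \<Rightarrow> (nat \<Rightarrow> complex) \<Rightarrow>
      (nat \<times> nat \<Rightarrow> 'h::complex_hilbert_space) \<Rightarrow> nat \<Rightarrow> 'h"
  where "exp_poly_sum s m lam v n =
    (\<Sum>i=1..s. \<Sum>j<m i. (of_nat n ^ j * lam i ^ n) *\<^sub>C v (i, j))"

text \<open>
  In addition to \<open>a (r - 1) \<noteq> 0\<close>, the main statement assumes that \<open>a 0\<close> and \<open>a 1\<close> are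
  not both zero, i.e. that 0 is at most a simple root of the characteristic polynomial. This
  hypothesis is not in the source, but the claim is false without it. If 0 is a root of multiplicity at least 2, the terms
  with \<open>\<lambda>\<^sub>i = 0\<close> and \<open>j \<ge> 1\<close> vanish for every \<open>n\<close>, so their coefficients are not
  unique (and a representation need not exist). For \<open>r = 2\<close> the assumption follows from
  \<open>a (r - 1) \<noteq> 0\<close>.
\<close>

end

theory Submission
  imports Defs "HOL-Computational_Algebra.Fundamental_Theorem_Algebra"
begin

text \<open>
  Let \<open>\<theta> = X \<cdot> d/dX\<close>. For a polynomial \<open>q\<close> one has
  \<open>(\<theta>\<^sup>j q)(\<lambda>) = \<Sum>\<^sub>n coeff q n \<cdot> n\<^sup>j \<lambda>\<^sup>n\<close>, so the linear map \<open>X\<^sup>n \<mapsto> n\<^sup>j \<lambda>\<^sup>n\<close> on polynomials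
  is evaluation of \<open>\<theta>\<^sup>j q\<close> at \<open>\<lambda>\<close>. Likewise a vector sequence \<open>u\<close> gives a linear map \<open>L\<^sub>u\<close> on
  polynomials that sends \<open>X\<^sup>n\<close> to \<open>u\<^sub>n\<close>, and \<open>u\<close> satisfies the recurrence exactly when \<open>L\<^sub>u\<close>
  annihilates every multiple of the characteristic polynomial \<open>P\<close>. The representation
  \<open>u\<^sub>n = \<Sum> v\<^sub>i\<^sub>j n\<^sup>j \<lambda>\<^sub>i\<^sup>n\<close> for all \<open>n\<close> then reads \<open>L\<^sub>u q = \<Sum> (\<theta>\<^sup>j q)(\<lambda>\<^sub>i) v\<^sub>i\<^sub>j\<close> for all \<open>q\<close>.

  Two facts on polynomials settle both existence and uniqueness.

  \<^item> Some polynomials \<open>q\<^sub>i\<^sub>j\<close> of degree below \<open>deg P\<close> are dual to the functionals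
    \<open>q \<mapsto> (\<theta>\<^sup>j q)(\<lambda>\<^sub>i)\<close> (Hermite interpolation, \<open>hermite_basis_exists\<close>).
    Applying \<open>L\<^sub>u\<close> to them forces \<open>v\<^sub>i\<^sub>j = L\<^sub>u q\<^sub>i\<^sub>j\<close>, which involves only
    \<open>u\<^sub>0, \<dots>, u\<^sub>r\<^sub>-\<^sub>1\<close>.
  \<^item> A polynomial on which all these functionals vanish is divisible by \<open>P\<close>
    (\<open>charpoly_dvd_if_euler_vanish\<close>). It applies to
    \<open>X\<^sup>n - \<Sum> n\<^sup>j \<lambda>\<^sub>i\<^sup>n q\<^sub>i\<^sub>j\<close>, and \<open>L\<^sub>u\<close> of this polynomial is then zero: that is the
    representation with \<open>v\<^sub>i\<^sub>j = L\<^sub>u q\<^sub>i\<^sub>j\<close>.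

  Both facts rest on one computation: if \<open>q = (X - \<lambda>)\<^sup>k Q\<close>, then \<open>(\<theta>\<^sup>j q)(\<lambda>)\<close> is zero for
  \<open>j < k\<close> and equals \<open>k! \<lambda>\<^sup>k Q(\<lambda>)\<close> for \<open>j = k\<close>. The latter is nonzero when \<open>Q(\<lambda>) \<noteq> 0\<close> and
  \<open>\<lambda> \<noteq> 0\<close>; for the root \<open>\<lambda> = 0\<close> only \<open>k = 0\<close> is harmless, so this root has to be simple.
\<close>

section \<open>The Euler operator on polynomials\<close>

definition euler :: "'a::idom poly \<Rightarrow> 'a poly"
  where "euler p = pCons 0 (pderiv p)"

lemma euler_add: "euler (p + q) = euler p + euler q"
  by (simp add: euler_def pderiv_add)

lemma euler_smult: "euler (smult c p) = smult c (euler p)"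
  by (simp add: euler_def pderiv_smult)

lemma funpow_euler_add:
  "(euler ^^ j) (p + q) = (euler ^^ j) p + (euler ^^ j) q"
  by (induction j) (simp_all add: euler_add)

lemma funpow_euler_smult:
  "(euler ^^ j) (smult c p) = smult c ((euler ^^ j) p)"
  by (induction j) (simp_all add: euler_smult)

lemma funpow_euler_0: "(euler ^^ j) 0 = 0"
  using funpow_euler_smult[of j 0 0] by simp

lemma funpow_euler_diff:
  "(euler ^^ j) (p - q) = (euler ^^ j) p - (euler ^^ j) q"
  using funpow_euler_add[of j "p - q" q] by simp

lemma funpow_euler_sum:
  "(euler ^^ j) (\<Sum>x\<in>A. f x) = (\<Sum>x\<in>A. (euler ^^ j) (f x))"
  by (induction A rule: infinite_finite_induct) (simp_all add: funpow_euler_0 funpow_euler_add)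

lemma coeff_euler: "coeff (euler p) n = of_nat n * coeff p n"
  by (cases n) (simp_all add: euler_def coeff_pderiv)

lemma coeff_funpow_euler: "coeff ((euler ^^ j) p) n = of_nat n ^ j * coeff p n"
  by (induction j) (simp_all add: coeff_euler mult_ac)

lemma degree_funpow_euler_le: "degree ((euler ^^ j) p) \<le> degree p"
  by (rule degree_le) (simp add: coeff_funpow_euler coeff_eq_0)

lemma poly_funpow_euler:
  "poly ((euler ^^ j) p) x = (\<Sum>n\<le>degree p. of_nat n ^ j * x ^ n * coeff p n)"
proof -
  have "poly ((euler ^^ j) p) x = (\<Sum>n\<le>degree p. coeff ((euler ^^ j) p) n * x ^ n)"
    unfolding poly_altdef using degree_funpow_euler_le[of j p]
    by (intro sum.mono_neutral_left) (auto simp: coeff_eq_0)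
  then show ?thesis
    by (simp add: coeff_funpow_euler mult_ac)
qed

text \<open>
  One application of the Euler operator to \<open>(X - x)\<^sup>k\<^sup>+\<^sup>1 Q\<close> leaves a factor \<open>(X - x)\<^sup>k\<close>, with a
  cofactor whose value at \<open>x\<close> is \<open>(k + 1) x Q(x)\<close>. Iterating gives both the vanishing below
  order \<open>k\<close> and the value at order \<open>k\<close>.
\<close>

lemma euler_linear_power_mult:
  fixes Q :: "'a::idom poly"
  shows "euler ([:-x, 1:] ^ Suc k * Q) =
    [:-x, 1:] ^ k * (smult (of_nat (Suc k)) ([:0, 1:] * Q) + [:-x, 1:] * euler Q)"
proof -
  have pCons_mult: "pCons 0 p = [:0, 1:] * p" for p :: "'a poly"
    by simp
  have "pderiv ([:-x, 1:] ^ Suc k * Q) =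
      [:-x, 1:] ^ k * (smult (of_nat (Suc k)) Q + [:-x, 1:] * pderiv Q)"
    by (simp only: pderiv_mult pderiv_power_Suc)
      (simp add: pderiv_pCons algebra_simps del: of_nat_Suc)
  then show ?thesis
    unfolding euler_def pCons_mult[of "pderiv _"]
    by (simp only: algebra_simps mult_smult_left mult_smult_right smult_add_right)
qed

lemma poly_funpow_euler_linear_power:
  fixes Q :: "'a::{idom,semiring_char_0} poly"
  assumes "j \<le> k"
  shows "poly ((euler ^^ j) ([:-x, 1:] ^ k * Q)) x =
    (if j = k then fact k * x ^ k * poly Q x else 0)"
  using assms
proof (induction j arbitrary: k Q)
  case 0
  then show ?case by (auto simp: power_0_left)
next
  case (Suc j)
  then obtain l where k: "k = Suc l" and "j \<le> l"
    by (cases k) auto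
  let ?R = "smult (of_nat (Suc l)) ([:0, 1:] * Q) + [:-x, 1:] * euler Q"
  have "poly ((euler ^^ Suc j) ([:-x, 1:] ^ k * Q)) x = poly ((euler ^^ j) ([:-x, 1:] ^ l * ?R)) x"
    unfolding k funpow_Suc_right o_apply euler_linear_power_mult ..
  also have "\<dots> = (if j = l then fact l * x ^ l * poly ?R x else 0)"
    by (rule Suc.IH) fact
  also have "\<dots> = (if Suc j = k then fact k * x ^ k * poly Q x else 0)"
    by (auto simp: k algebra_simps)
  finally show ?case .
qed

lemma poly_funpow_euler_eq_0:
  fixes q :: "'a::{idom,semiring_char_0} poly"
  assumes "[:-x, 1:] ^ k dvd q" and "j < k"
  shows "poly ((euler ^^ j) q) x = 0"
  using assms poly_funpow_euler_linear_power[of j k x] by (auto elim!: dvdE)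

section \<open>Divisibility and Hermite interpolation\<close>

text \<open>
  If \<open>q\<close> had order \<open>k < m\<close> at \<open>x\<close>, then \<open>\<theta>\<^sup>k q\<close> would take the nonzero value \<open>k! x\<^sup>k Q(x)\<close> there.
  For \<open>x = 0\<close> the bound \<open>m \<le> 1\<close> leaves only the case \<open>k = 0\<close>, where \<open>x\<^sup>k = 1\<close>.
\<close>

lemma linear_power_dvd_if_euler_vanish:
  fixes q :: "'a::{idom,semiring_char_0} poly"
  assumes vanish: "\<And>j. j < m \<Longrightarrow> poly ((euler ^^ j) q) x = 0"
    and simple: "x = 0 \<Longrightarrow> m \<le> 1"
  shows "[:-x, 1:] ^ m dvd q"
proof (rule ccontr)
  assume *: "\<not> ?thesis"
  then have "q \<noteq> 0" and less: "order x q < m"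
    by (auto simp: order_divides)
  define k where "k = order x q"
  from order_decomp[OF \<open>q \<noteq> 0\<close>, of x] obtain Q where
    Q: "q = [:-x, 1:] ^ k * Q" and "\<not> [:-x, 1:] dvd Q"
    unfolding k_def by blast
  then have "poly Q x \<noteq> 0"
    by (simp add: poly_eq_0_iff_dvd)
  moreover have "x ^ k \<noteq> 0"
  proof (cases "x = 0")
    case True
    then have "k = 0"
      using simple less by (simp add: k_def)
    then show ?thesis
      by simp
  qed simp
  ultimately have "poly ((euler ^^ k) q) x \<noteq> 0"
    unfolding Q by (subst poly_funpow_euler_linear_power) simp_all
  then show False
    using vanish less by (simp add: k_def)
qed

text \<open>
  Over the complex numbers a nonzero polynomial is, up to a constant, the product of the linear
  factors of its multiset of roots, so divisibility is inclusion of these multisets.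
\<close>

lemma complex_poly_dvd_if_order_le:
  fixes p q :: "complex poly"
  assumes "p \<noteq> 0" and "q \<noteq> 0" and "\<And>z. order z p \<le> order z q"
  shows "p dvd q"
proof -
  have "proots p \<subseteq># proots q"
    using assms by (simp add: subseteq_mset_def)
  then have "(\<Prod>x\<in>#proots p. [:-x, 1:]) dvd (\<Prod>x\<in>#proots q. [:-x, 1:])"
    by (intro prod_mset_subset_imp_dvd image_mset_subseteq_mono)
  then have "smult (lead_coeff p) (\<Prod>x\<in>#proots p. [:-x, 1:])
      dvd smult (lead_coeff q) (\<Prod>x\<in>#proots q. [:-x, 1:])"
    using \<open>p \<noteq> 0\<close> by (simp add: smult_dvd_iff dvd_smult)
  then show ?thesis
    by (simp only: complex_poly_decompose_multiset)
qed

lemma charpoly_dvd_if_euler_vanish: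
  fixes P q :: "complex poly"
  assumes "P \<noteq> 0" and simple: "order 0 P \<le> 1"
    and vanish: "\<And>z j. poly P z = 0 \<Longrightarrow> j < order z P \<Longrightarrow> poly ((euler ^^ j) q) z = 0"
  shows "P dvd q"
proof (cases "q = 0")
  case False
  have "order z P \<le> order z q" for z
  proof (cases "poly P z = 0")
    case True
    then have "[:-z, 1:] ^ order z P dvd q"
      using vanish simple by (intro linear_power_dvd_if_euler_vanish) auto
    then show ?thesis
      using False by (simp add: order_divides)
  qed (simp add: order_0I)
  then show ?thesis
    using assms(1) False by (intro complex_poly_dvd_if_order_le)
qed simp

text \<open>
  Write \<open>P = (X - z)\<^sup>m Q\<close> with \<open>Q(z) \<noteq> 0\<close>. Multiples of \<open>Q\<close> have vanishing conditions at all
  other roots, and at \<open>z\<close> the matrix of \<open>\<theta>\<^sup>k\<close> on the polynomials \<open>(X - z)\<^sup>j Q\<close> is triangular with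
  nonzero diagonal \<open>j! z\<^sup>j Q(z)\<close>. The proof is the back substitution, by induction on \<open>m - j\<close>.
\<close>

lemma hermite_basis_exists:
  fixes P :: "'a::field_char_0 poly"
  assumes "P \<noteq> 0" and simple: "order 0 P \<le> 1" and "j < order z P"
  shows "\<exists>q. degree q < degree P \<and>
    (\<forall>w k. k < order w P \<longrightarrow> poly ((euler ^^ k) q) w = (if w = z \<and> k = j then 1 else 0))"
  using \<open>j < order z P\<close>
proof (induction "order z P - j" arbitrary: j rule: less_induct)
  case less
  define m where "m = order z P"
  from order_decomp[OF \<open>P \<noteq> 0\<close>, of z] obtain Q where
    P: "P = [:-z, 1:] ^ m * Q" and "\<not> [:-z, 1:] dvd Q"
    unfolding m_def by blast
  then have Qz: "poly Q z \<noteq> 0"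
    by (simp add: poly_eq_0_iff_dvd)
  have "Q \<noteq> 0"
    using Qz by auto
  have "z ^ j \<noteq> 0"
  proof (cases "z = 0")
    case True
    then have "j = 0"
      using simple less.prems by simp
    then show ?thesis
      by simp
  qed simp
  define c where "c = inverse (fact j * z ^ j * poly Q z)"
  define q0 where "q0 = smult c ([:-z, 1:] ^ j * Q)"
  have deg_q0: "degree q0 < degree P"
  proof -
    have "degree q0 \<le> degree ([:-z, 1:] ^ j * Q)"
      unfolding q0_def by (rule degree_smult_le)
    also have "\<dots> < degree P"
    proof -
      have "degree ([:-z, 1:] ^ k * Q) = k + degree Q" for k
        using \<open>Q \<noteq> 0\<close> by (subst degree_mult_eq) (simp_all add: degree_power_eq)
      then show ?thesis
        using less.prems[folded m_def] unfolding P by simp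
    qed
    finally show ?thesis .
  qed
  have "c * (fact j * z ^ j * poly Q z) = 1"
    unfolding c_def using Qz \<open>z ^ j \<noteq> 0\<close> by (intro left_inverse) simp
  then have q0_z: "poly ((euler ^^ k) q0) z = (if k = j then 1 else 0)" if "k \<le> j" for k
    using that unfolding q0_def funpow_euler_smult poly_smult
    by (subst poly_funpow_euler_linear_power) auto
  have q0_other: "poly ((euler ^^ k) q0) w = 0" if "w \<noteq> z" "k < order w P" for w k
  proof -
    have "order w ([:-z, 1:] ^ m) = 0"
      using \<open>w \<noteq> z\<close> by (intro order_0I) simp
    then have "order w P = order w Q"
      using \<open>P \<noteq> 0\<close> by (simp add: P order_mult)
    then have "[:-w, 1:] ^ order w P dvd Q"
      by (metis order_1)
    then have "[:-w, 1:] ^ order w P dvd q0"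
      unfolding q0_def by (intro dvd_smult dvd_mult)
    then show ?thesis
      using that by (intro poly_funpow_euler_eq_0)
  qed
  have "\<exists>q. degree q < degree P \<and>
      (\<forall>w k. k < order w P \<longrightarrow> poly ((euler ^^ k) q) w = (if w = z \<and> k = l then 1 else 0))"
    if "l \<in> {j<..<m}" for l
    using that by (intro less.hyps) (auto simp: m_def)
  then obtain b where
    deg_b: "\<And>l. l \<in> {j<..<m} \<Longrightarrow> degree (b l) < degree P" and
    b: "\<And>l w k. l \<in> {j<..<m} \<Longrightarrow> k < order w P \<Longrightarrow>
      poly ((euler ^^ k) (b l)) w = (if w = z \<and> k = l then 1 else 0)"
    by metis
  \<comment> \<open>Only the derivatives of orders \<open>l > j\<close> at \<open>z\<close> can still be wrong for \<open>q0\<close>; the dual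
    polynomials \<open>b l\<close> of these orders cancel them without disturbing any other condition.\<close>
  define e where "e l = poly ((euler ^^ l) q0) z" for l
  define q where "q = q0 - (\<Sum>l\<in>{j<..<m}. smult (e l) (b l))"
  have "degree (\<Sum>l\<in>{j<..<m}. smult (e l) (b l)) < degree P"
    using deg_q0 deg_b by (intro degree_sum_less) (auto intro: le_less_trans[OF degree_smult_le])
  then have "degree q < degree P"
    unfolding q_def using deg_q0 by (intro degree_diff_less)
  moreover have "poly ((euler ^^ k) q) w = (if w = z \<and> k = j then 1 else 0)"
    if "k < order w P" for w k
  proof -
    have "poly ((euler ^^ k) q) w = poly ((euler ^^ k) q0) w -
        (\<Sum>l\<in>{j<..<m}. e l * poly ((euler ^^ k) (b l)) w)"
      by (simp add: q_def funpow_euler_diff funpow_euler_sum funpow_euler_smult poly_sum)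
    also have "(\<Sum>l\<in>{j<..<m}. e l * poly ((euler ^^ k) (b l)) w) =
        (\<Sum>l\<in>{j<..<m}. if l = k then if w = z then e l else 0 else 0)"
      using b that by (intro sum.cong refl) simp
    also have "\<dots> = (if w = z \<and> k \<in> {j<..<m} then e k else 0)"
      by simp
    also have "poly ((euler ^^ k) q0) w - \<dots> = (if w = z \<and> k = j then 1 else 0)"
    proof (cases "w = z")
      case True
      then have "k < m"
        using that by (simp add: m_def)
      then show ?thesis
        using q0_z[of k] True by (cases "k \<le> j") (auto simp: e_def)
    qed (use q0_other that in simp)
    finally show ?thesis .
  qed
  ultimately show ?case
    by blast
qed

section \<open>Vector sequences as functionals on polynomials\<close>

interpretation scaleC: vector_space "scaleC :: complex \<Rightarrow> 'h \<Rightarrow> 'h::complex_hilbert_space"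
proof
  show "1 *\<^sub>C x = x" for x :: 'h
    using scaleR_eq_scaleC[of 1 x] by simp
qed (simp_all add: scaleC_add_right scaleC_add_left scaleC_scaleC)

text \<open>
  The linear extension of \<open>X\<^sup>n \<mapsto> u\<^sub>n\<close>, written \<open>L\<^sub>u\<close> in the introduction.
\<close>

definition umbral :: "(nat \<Rightarrow> 'h::complex_hilbert_space) \<Rightarrow> complex poly \<Rightarrow> 'h"
  where "umbral u q = (\<Sum>n\<le>degree q. coeff q n *\<^sub>C u n)"

lemma umbral_eq_sum_lessThan:
  assumes "degree q < N"
  shows "umbral u q = (\<Sum>n<N. coeff q n *\<^sub>C u n)"
  unfolding umbral_def using assms
  by (intro sum.mono_neutral_left) (auto simp: coeff_eq_0)

lemma umbral_add: "umbral u (p + q) = umbral u p + umbral u q"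
proof -
  define N where "N = Suc (max (degree p) (degree q))"
  have "degree p < N" "degree q < N" "degree (p + q) < N"
    using degree_add_le_max[of p q] by (auto simp: N_def)
  then show ?thesis
    by (simp add: umbral_eq_sum_lessThan[of _ N] scaleC.scale_left_distrib sum.distrib)
qed

lemma umbral_smult: "umbral u (smult c q) = c *\<^sub>C umbral u q"
proof -
  have "degree (smult c q) < Suc (degree q)"
    using degree_smult_le[of c q] by simp
  then show ?thesis
    by (simp add: umbral_eq_sum_lessThan[of _ "Suc (degree q)"] scaleC.scale_sum_right
        del: sum.lessThan_Suc)
qed

lemma umbral_0: "umbral u 0 = 0"
  by (simp add: umbral_def)

lemma umbral_diff: "umbral u (p - q) = umbral u p - umbral u q"
  using umbral_add[of u "p - q" q] by simp

lemma umbral_sum: "umbral u (\<Sum>x\<in>A. f x) = (\<Sum>x\<in>A. umbral u (f x))"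
  by (induction A rule: infinite_finite_induct) (simp_all add: umbral_0 umbral_add)

lemma umbral_monom: "umbral u (monom c n) = c *\<^sub>C u n"
proof -
  have "umbral u (monom c n) = (\<Sum>k<Suc n. (if k = n then c else 0) *\<^sub>C u k)"
    by (subst umbral_eq_sum_lessThan[of _ "Suc n"])
      (auto simp: le_imp_less_Suc degree_monom_le coeff_monom intro!: sum.cong)
  then show ?thesis
    by simp
qed

text \<open>
  Both sides are linear in \<open>q\<close> and agree on \<open>X\<^sup>n\<close>. This turns the evaluation of a generalized
  power sum into conditions on \<open>q\<close> at the roots, where the dual polynomials can pick out a single
  vector.
\<close>

lemma umbral_exp_poly_sum:
  "umbral (exp_poly_sum s m lam v) q =
    (\<Sum>i=1..s. \<Sum>j<m i. poly ((euler ^^ j) q) (lam i) *\<^sub>C v (i, j))"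
proof -
  have "umbral (exp_poly_sum s m lam v) q =
      (\<Sum>n\<le>degree q. \<Sum>i=1..s. \<Sum>j<m i. (of_nat n ^ j * lam i ^ n * coeff q n) *\<^sub>C v (i, j))"
    by (simp add: umbral_def exp_poly_sum_def scaleC.scale_sum_right mult_ac)
  also have "\<dots> =
      (\<Sum>i=1..s. \<Sum>j<m i. \<Sum>n\<le>degree q. (of_nat n ^ j * lam i ^ n * coeff q n) *\<^sub>C v (i, j))"
    by (subst sum.swap, rule sum.cong[OF refl], rule sum.swap)
  finally show ?thesis
    by (simp add: poly_funpow_euler scaleC.scale_sum_left)
qed

section \<open>Linear recurrences\<close>

lemma coeff_rec_charpoly:
  "coeff (rec_charpoly r a) n =
    (if n = r then 1 else 0) - (if n < r then complex_of_real (a n) else 0)"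
  by (simp add: rec_charpoly_def coeff_sum coeff_monom)

lemma degree_rec_charpoly: "degree (rec_charpoly r a) = r"
  by (intro antisym degree_le le_degree) (auto simp: coeff_rec_charpoly)

text \<open>
  On \<open>X\<^sup>n P\<close>, with \<open>P\<close> the characteristic polynomial, the functional of \<open>u\<close> takes the value
  \<open>u\<^sub>n\<^sub>+\<^sub>r - \<Sum>\<^sub>k a\<^sub>k u\<^sub>n\<^sub>+\<^sub>k = 0\<close>, and these polynomials span the multiples of \<open>P\<close>.
\<close>

lemma umbral_multiple_rec_charpoly:
  fixes u :: "nat \<Rightarrow> 'h::complex_hilbert_space"
  assumes recurrence: "\<And>n. u (n + r) = (\<Sum>k<r. a k *\<^sub>R u (n + k))"
    and "rec_charpoly r a dvd q"
  shows "umbral u q = 0"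
proof -
  let ?P = "rec_charpoly r a"
  have shift: "umbral u (monom c n * ?P) = 0" for c n
  proof -
    have "monom c n * ?P = monom c (n + r) - (\<Sum>k<r. monom (c * complex_of_real (a k)) (n + k))"
      by (simp add: rec_charpoly_def right_diff_distrib sum_distrib_left mult_monom)
    then show ?thesis
      by (simp add: umbral_diff umbral_sum umbral_monom recurrence scaleR_eq_scaleC
          scaleC.scale_sum_right)
  qed
  obtain g where "q = g * ?P"
    using assms(2) by (metis dvdE mult.commute)
  also have "\<dots> = (\<Sum>n\<le>degree g. monom (coeff g n) n * ?P)"
    by (simp add: poly_as_sum_of_monoms flip: sum_distrib_right)
  finally show ?thesis
    by (simp add: umbral_sum shift)
qed

text \<open>
  The second part of the conclusion says that agreement in the first \<open>r\<close> terms already forces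
  equality of the coefficient families. The uniqueness argument below uses the functional of \<open>u\<close>
  only on polynomials of degree less than \<open>r\<close>, so it gives both parts at once.
\<close>

theorem theorem4p1:
  fixes r s :: nat
    and a :: "nat \<Rightarrow> real"
    and lam :: "nat \<Rightarrow> complex"
    and m :: "nat \<Rightarrow> nat"
    and u :: "nat \<Rightarrow> 'h::complex_hilbert_space"
  assumes separable: "\<exists>D::'h set. countable D \<and> closure D = UNIV"
    and r: "r \<ge> 2"
    and last_coeff: "a (r - 1) \<noteq> 0"
    and zero_simple: "a 0 \<noteq> 0 \<or> a 1 \<noteq> 0"
    and roots: "bij_betw lam {1..s} {z. poly (rec_charpoly r a) z = 0}"
    and mults: "\<And>i. i \<in> {1..s} \<Longrightarrow> m i = order (lam i) (rec_charpoly r a)"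
    and recurrence: "\<And>n. u (n + r) = (\<Sum>k<r. a k *\<^sub>R u (n + k))"
  shows "(\<exists>!v. v \<in> mult_index s m \<rightarrow>\<^sub>E UNIV \<and> (\<forall>n. u n = exp_poly_sum s m lam v n))
    \<and> (\<forall>v \<in> mult_index s m \<rightarrow>\<^sub>E UNIV. \<forall>w \<in> mult_index s m \<rightarrow>\<^sub>E UNIV.
          (\<forall>n. u n = exp_poly_sum s m lam v n) \<longrightarrow>
          (\<forall>n<r. u n = exp_poly_sum s m lam w n) \<longrightarrow> w = v)"
proof -
  define P where "P = rec_charpoly r a"
  have deg_P: "degree P = r"
    by (simp add: P_def degree_rec_charpoly)
  then have "P \<noteq> 0"
    using r by auto
  \<comment> \<open>A double root at zero would kill the two lowest coefficients \<open>- a 0\<close> and \<open>- a 1\<close>.\<close>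
  have simple: "order 0 P \<le> 1"
  proof (rule ccontr)
    assume "\<not> order 0 P \<le> 1"
    then have "[:-0, 1:] ^ 2 dvd P"
      using \<open>P \<noteq> 0\<close> by (subst order_divides) simp
    then obtain g where "P = [:0, 1:] ^ 2 * g"
      by (metis dvdE minus_zero)
    then have "coeff P 0 = 0 \<and> coeff P 1 = 0"
      by (simp add: power2_eq_square)
    then show False
      using zero_simple r by (simp add: P_def coeff_rec_charpoly)
  qed
  have inj: "lam k = lam i \<longleftrightarrow> k = i" if "k \<in> {1..s}" "i \<in> {1..s}" for k i
    using inj_on_eq_iff[OF bij_betw_imp_inj_on[OF roots]] that by blast

  have "\<exists>q. degree q < r \<and> (\<forall>k\<in>{1..s}. \<forall>l<m k.
      poly ((euler ^^ l) q) (lam k) = (if k = i \<and> l = j then 1 else 0))"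
    if "(i, j) \<in> mult_index s m" for i j
  proof -
    have "i \<in> {1..s}" and "j < order (lam i) P"
      using that mults by (auto simp: mult_index_def P_def)
    then obtain q where "degree q < r" and
      q: "\<And>w l. l < order w P \<Longrightarrow>
        poly ((euler ^^ l) q) w = (if w = lam i \<and> l = j then 1 else 0)"
      using hermite_basis_exists[OF \<open>P \<noteq> 0\<close> simple] unfolding deg_P by blast
    moreover have "poly ((euler ^^ l) q) (lam k) = (if k = i \<and> l = j then 1 else 0)"
      if "k \<in> {1..s}" "l < m k" for k l
      using q[of l "lam k"] that mults[of k] inj[of k i] \<open>i \<in> {1..s}\<close> by (simp add: P_def)
    ultimately show ?thesis
      by blast
  qed
  then obtain b where
    deg_b: "\<And>i j. (i, j) \<in> mult_index s m \<Longrightarrow> degree (b i j) < r" and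
    b: "\<And>i j k l. (i, j) \<in> mult_index s m \<Longrightarrow> k \<in> {1..s} \<Longrightarrow> l < m k \<Longrightarrow>
      poly ((euler ^^ l) (b i j)) (lam k) = (if k = i \<and> l = j then 1 else 0)"
    by metis

  \<comment> \<open>The dual polynomials have degree below \<open>r\<close>, so this depends on \<open>u 0, ..., u (r - 1)\<close> only.\<close>
  define v where "v = (\<lambda>x\<in>mult_index s m. umbral u (b (fst x) (snd x)))"
  have v_ext: "v \<in> mult_index s m \<rightarrow>\<^sub>E UNIV"
    by (auto simp: v_def)
  have representation: "u n = exp_poly_sum s m lam v n" for n
  proof -
    \<comment> \<open>\<open>X\<^sup>n\<close> minus its Hermite interpolant: all functionals vanish on the difference.\<close>
    define q where "q = monom 1 n - (\<Sum>i=1..s. \<Sum>j<m i. smult (of_nat n ^ j * lam i ^ n) (b i j))"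
    have "P dvd q"
    proof (rule charpoly_dvd_if_euler_vanish[OF \<open>P \<noteq> 0\<close> simple])
      fix z l
      assume "poly P z = 0" and "l < order z P"
      then obtain k where k: "k \<in> {1..s}" "z = lam k" "l < m k"
        using bij_betw_imp_surj_on[OF roots] mults unfolding P_def
        by (metis (mono_tags) imageE mem_Collect_eq)
      have monom: "poly ((euler ^^ l) (monom 1 n)) z = of_nat n ^ l * z ^ n"
      proof -
        have "(euler ^^ l) (monom 1 n) = (monom (of_nat n ^ l) n :: complex poly)"
          by (rule poly_eqI) (simp add: coeff_funpow_euler coeff_monom)
        then show ?thesis
          by (simp add: poly_monom)
      qed
      have "(\<Sum>i=1..s. \<Sum>j<m i. of_nat n ^ j * lam i ^ n * poly ((euler ^^ l) (b i j)) z) =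
          (\<Sum>i=1..s. \<Sum>j<m i. if i = k then if j = l then of_nat n ^ j * lam i ^ n else 0 else 0)"
      proof (intro sum.cong refl)
        fix i j
        assume "i \<in> {1..s}" and "j \<in> {..<m i}"
        then have "poly ((euler ^^ l) (b i j)) z = (if k = i \<and> l = j then 1 else 0)"
          unfolding k(2) using k(1,3) by (intro b) (simp_all add: mult_index_def)
        then show "of_nat n ^ j * lam i ^ n * poly ((euler ^^ l) (b i j)) z =
            (if i = k then if j = l then of_nat n ^ j * lam i ^ n else 0 else 0)"
          by simp
      qed
      also have "\<dots> = (\<Sum>i=1..s. if i = k then of_nat n ^ l * lam i ^ n else 0)"
        using k(3) by (intro sum.cong refl) simp
      also have "\<dots> = of_nat n ^ l * z ^ n"
        using k(1) by (simp add: k(2))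
      finally show "poly ((euler ^^ l) q) z = 0"
        by (simp add: q_def funpow_euler_diff funpow_euler_sum funpow_euler_smult poly_sum monom)
    qed
    then have "0 = umbral u q"
      using umbral_multiple_rec_charpoly[of u r a q] recurrence by (simp add: P_def)
    also have "\<dots> = u n -
        (\<Sum>i=1..s. \<Sum>j<m i. (of_nat n ^ j * lam i ^ n) *\<^sub>C umbral u (b i j))"
      by (simp add: q_def umbral_diff umbral_sum umbral_smult umbral_monom)
    also have "(\<Sum>i=1..s. \<Sum>j<m i. (of_nat n ^ j * lam i ^ n) *\<^sub>C umbral u (b i j)) =
        exp_poly_sum s m lam v n"
      unfolding exp_poly_sum_def by (intro sum.cong refl) (simp add: v_def mult_index_def)
    finally show ?thesis
      by simp
  qed

  have determined: "w = v"
    if w: "w \<in> mult_index s m \<rightarrow>\<^sub>E UNIV" and init: "\<And>n. n < r \<Longrightarrow> u n = exp_poly_sum s m lam w n"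
    for w
  proof (rule PiE_ext[OF w v_ext])
    fix x
    assume x: "x \<in> mult_index s m"
    obtain i j where ij: "x = (i, j)"
      by fastforce
    then have "i \<in> {1..s}" and "j < m i"
      using x by (auto simp: mult_index_def)
    have "v x = umbral u (b i j)"
      using x by (simp add: v_def ij)
    also have "\<dots> = umbral (exp_poly_sum s m lam w) (b i j)"
      using deg_b x init by (simp add: ij umbral_eq_sum_lessThan[of _ r])
    also have "\<dots> = (\<Sum>k=1..s. \<Sum>l<m k. poly ((euler ^^ l) (b i j)) (lam k) *\<^sub>C w (k, l))"
      by (rule umbral_exp_poly_sum)
    also have "\<dots> = (\<Sum>k=1..s. \<Sum>l<m k. if k = i then if l = j then w (k, l) else 0 else 0)"
      using x by (intro sum.cong refl) (simp add: b ij)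
    also have "\<dots> = (\<Sum>k=1..s. if k = i then w (k, j) else 0)"
      using \<open>j < m i\<close> by (intro sum.cong refl) simp
    also have "\<dots> = w x"
      using \<open>i \<in> {1..s}\<close> by (simp add: ij)
    finally show "w x = v x" ..
  qed

  show ?thesis
  proof (intro conjI ballI impI)
    show "\<exists>!v. v \<in> mult_index s m \<rightarrow>\<^sub>E UNIV \<and> (\<forall>n. u n = exp_poly_sum s m lam v n)"
    proof (rule ex1I[of _ v])
      fix w
      assume "w \<in> mult_index s m \<rightarrow>\<^sub>E UNIV \<and> (\<forall>n. u n = exp_poly_sum s m lam w n)"
      then show "w = v"
        by (intro determined) simp_all
    qed (use v_ext representation in simp)
  next
    fix v' w
    assume v': "v' \<in> mult_index s m \<rightarrow>\<^sub>E UNIV" "\<forall>n. u n = exp_poly_sum s m lam v' n"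
      and w: "w \<in> mult_index s m \<rightarrow>\<^sub>E UNIV" "\<forall>n<r. u n = exp_poly_sum s m lam w n"
    have "v' = v"
      using v'(2) by (intro determined[OF v'(1)]) blast
    moreover have "w = v"
      using w(2) by (intro determined[OF w(1)]) blast
    ultimately show "w = v'"
      by blast
  qed
qed

end
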